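(* Let $A:\mathcal{D}(A)\to H$ be a closed, densely defined linear operator in a Hilbert space $H$, and let $\varphi\in\mathcal{D}(A^* )$ satisfy $A^*\varphi=\lambda_0\varphi$ with $\lambda_0\in\mathbf{R}\setminus\{0\}$ and $\|\varphi\|=1$. Let $T>0$, $f\in C^1([0,T];H)$, $u_0\in\mathcal{D}(A)$, $u_1\in H$ with $(u_0,\varphi)\neq 0$, and let $g\in C^2([0,T])$. Assume that for every kernel $h$ occurring in a solution $(u,h)$ of the identification problem (IP), the direct problem with that $h$ has a unique solution in $C^2([0,T];H)\cap C([0,T];\mathcal{D}(A))$. Then the identification problem (IP) with data $(A,\varphi,u_0,u_1,f,g)$ has at most one solution $(u,h)$.
   Context: $(\cdot,\cdot)$ and $\|\cdot\|$ are the scalar product and norm of $H$; $\mathcal{D}(A)$ carries the graph norm. For a kernel $h\in C([0,T])=C([0,T];\mathbf{R})$ the direct problem is $$u''(t)=\int_0^t h(t-s)Au(s)\,ds+f(t),\quad 0\le t\le T,\qquad u(0)=u_0,\quad u'(0)=u_1.$$ The identification problem (IP) is: given the data $(A,\varphi,u_0,u_1,f,g)$, find a pair $(u,h)$ with $u\in C^2([0,T];H)\cap C([0,T];\mathcal{D}(A))$ and $h\in C([0,T];\mathbf{R})$ such that $u$ solves the direct problem with kernel $h$ and $$(u(t),\varphi)=g(t),\qquad 0\le t\le T.$$ *)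

theory Defs
  imports "HOL-Analysis.Analysis"
begin

text \<open>
  Scalar fields of Hilbert spaces, with conjugation. By the Gelfand--Mazur theorem a real
  normed field is isomorphic to the reals or to the complex numbers, so that the class covers
  exactly real and complex Hilbert spaces.
\<close>

class rc_field = real_normed_field +
  fixes conj :: "'a \<Rightarrow> 'a"
  assumes conj_add: "conj (a + b) = conj a + conj b"
    and conj_mult: "conj (a * b) = conj a * conj b"
    and conj_scaleR: "conj (r *\<^sub>R a) = r *\<^sub>R conj a"
    and conj_conj: "conj (conj a) = a"
    and mult_conj: "a * conj a = (norm a)\<^sup>2 *\<^sub>R 1"

instantiation real :: rc_field
begin
definition conj_real :: "real \<Rightarrow> real" where "conj_real a = a"
instance by standard (auto simp: conj_real_def power2_eq_square)
end

instantiation complex :: rc_field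
begin
definition conj_complex :: "complex \<Rightarrow> complex" where "conj_complex = cnj"
instance
  by standard
    (simp_all add: conj_complex_def complex_norm_square[symmetric] scaleR_conv_of_real
      del: of_real_power)
end

text \<open>
  Completeness is part of the class \<open>banach\<close>, whose real scalar multiplication and norm are
  required to be those induced by \<open>smul\<close> and by the scalar product \<open>ip\<close>.
\<close>

locale hilbert_space = vector_space smul
  for smul :: "'k::rc_field \<Rightarrow> 'h::banach \<Rightarrow> 'h" +
  fixes ip :: "'h \<Rightarrow> 'h \<Rightarrow> 'k"
  assumes smul_of_real: "smul (of_real r) x = r *\<^sub>R x"
    and ip_add_left: "ip (x + y) z = ip x z + ip y z"
    and ip_smul_left: "ip (smul c x) y = c * ip x y"
    and ip_commute: "ip x y = conj (ip y x)"
    and ip_self: "ip x x = of_real ((norm x)\<^sup>2)"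

lemma hilbert_space_real_inner:
  "hilbert_space (*\<^sub>R) (inner :: 'h::{real_inner,banach} \<Rightarrow> 'h \<Rightarrow> real)"
  by unfold_locales
    (auto simp: conj_real_def inner_add_left inner_add_right inner_commute power2_norm_eq_inner
      scaleR_add_right scaleR_add_left)

lemma hilbert_space_complex: "hilbert_space (*) (\<lambda>x y :: complex. x * cnj y)"
  by unfold_locales
    (auto simp: conj_complex_def algebra_simps scaleR_conv_of_real complex_norm_square[symmetric]
      simp del: of_real_power)

text \<open>
  An unbounded operator is a pair of its domain \<open>D\<close> and a function \<open>A\<close> that matters only on \<open>D\<close>.
\<close>

definition linear_operator ::
  "('k::field \<Rightarrow> 'h::ab_group_add \<Rightarrow> 'h) \<Rightarrow> 'h set \<Rightarrow> ('h \<Rightarrow> 'h) \<Rightarrow> bool" where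
  "linear_operator smul D A \<longleftrightarrow> module.subspace smul D \<and>
     (\<forall>x\<in>D. \<forall>y\<in>D. A (x + y) = A x + A y) \<and>
     (\<forall>c. \<forall>x\<in>D. A (smul c x) = smul c (A x))"

definition closed_operator :: "'h::topological_space set \<Rightarrow> ('h \<Rightarrow> 'h) \<Rightarrow> bool" where
  "closed_operator D A \<longleftrightarrow> closed {(x, A x) | x. x \<in> D}"

definition densely_defined :: "'h::topological_space set \<Rightarrow> bool" where
  "densely_defined D \<longleftrightarrow> closure D = UNIV"

definition adj_dom :: "('h \<Rightarrow> 'h \<Rightarrow> 'k) \<Rightarrow> 'h set \<Rightarrow> ('h \<Rightarrow> 'h) \<Rightarrow> 'h set" where
  "adj_dom ip D A = {y. \<exists>z. \<forall>x\<in>D. ip (A x) y = ip x z}"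

definition adj :: "('h \<Rightarrow> 'h \<Rightarrow> 'k) \<Rightarrow> 'h set \<Rightarrow> ('h \<Rightarrow> 'h) \<Rightarrow> 'h \<Rightarrow> 'h" where
  "adj ip D A y = (THE z. \<forall>x\<in>D. ip (A x) y = ip x z)"

definition graph_norm :: "('h::real_normed_vector \<Rightarrow> 'h) \<Rightarrow> 'h \<Rightarrow> real" where
  "graph_norm A x = norm x + norm (A x)"

definition continuous_on_graph ::
  "real set \<Rightarrow> 'h set \<Rightarrow> ('h::real_normed_vector \<Rightarrow> 'h) \<Rightarrow> (real \<Rightarrow> 'h) \<Rightarrow> bool" where
  "continuous_on_graph S D A u \<longleftrightarrow> (\<forall>t\<in>S. u t \<in> D) \<and>
     (\<forall>t\<in>S. ((\<lambda>s. graph_norm A (u s - u t)) \<longlongrightarrow> 0) (at t within S))"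

text \<open>
  Derivatives on \<open>{0..T}\<close> are one-sided at the end points, and functions on \<open>{0..T}\<close> are functions
  on all reals whose values outside of the interval are irrelevant.
\<close>

primrec Ck_on :: "nat \<Rightarrow> real set \<Rightarrow> (real \<Rightarrow> 'a::real_normed_vector) \<Rightarrow> bool" where
  "Ck_on 0 S u \<longleftrightarrow> continuous_on S u"
| "Ck_on (Suc k) S u \<longleftrightarrow>
     (\<exists>u'. (\<forall>t\<in>S. (u has_vector_derivative u' t) (at t within S)) \<and> Ck_on k S u')"

definition deriv_on :: "real set \<Rightarrow> (real \<Rightarrow> 'a::real_normed_vector) \<Rightarrow> real \<Rightarrow> 'a" where
  "deriv_on S u t = vector_derivative u (at t within S)"

definition direct_solution ::
  "real \<Rightarrow> 'h set \<Rightarrow> ('h::real_normed_vector \<Rightarrow> 'h) \<Rightarrow> 'h \<Rightarrow> 'h \<Rightarrow> (real \<Rightarrow> 'h) \<Rightarrow>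
     (real \<Rightarrow> real) \<Rightarrow> (real \<Rightarrow> 'h) \<Rightarrow> bool" where
  "direct_solution T D A u0 u1 f h u \<longleftrightarrow>
     Ck_on 2 {0..T} u \<and> continuous_on_graph {0..T} D A u \<and>
     (\<forall>t\<in>{0..T}. deriv_on {0..T} (deriv_on {0..T} u) t =
        integral {0..t} (\<lambda>s. h (t - s) *\<^sub>R A (u s)) + f t) \<and>
     u 0 = u0 \<and> deriv_on {0..T} u 0 = u1"

definition IP_solution ::
  "('h \<Rightarrow> 'h \<Rightarrow> 'k::rc_field) \<Rightarrow> real \<Rightarrow> 'h set \<Rightarrow> ('h::real_normed_vector \<Rightarrow> 'h) \<Rightarrow> 'h \<Rightarrow>
     'h \<Rightarrow> 'h \<Rightarrow> (real \<Rightarrow> 'h) \<Rightarrow> (real \<Rightarrow> real) \<Rightarrow> (real \<Rightarrow> 'h) \<Rightarrow> (real \<Rightarrow> real) \<Rightarrow> bool" where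
  "IP_solution ip T D A \<phi> u0 u1 f g u h \<longleftrightarrow>
     continuous_on {0..T} h \<and> direct_solution T D A u0 u1 f h u \<and>
     (\<forall>t\<in>{0..T}. ip (u t) \<phi> = of_real (g t))"

end

theory Submission
  imports Defs
begin

text \<open>
  Pairing the equation with \<open>\<phi>\<close> and using \<open>A\<^sup>*\<phi> = \<lambda>\<^sub>0\<phi>\<close> turns it into the scalar identity
  \<open>g''(t) = \<lambda>\<^sub>0 \<integral>\<^sub>0\<^sup>t h(t - s) g(s) ds + (f(t), \<phi>)\<close>. Hence the difference \<open>p\<close> of two kernels
  satisfies the Volterra equation of the first kind \<open>\<integral>\<^sub>0\<^sup>t p(t - s) g(s) ds = 0\<close>. Integrating by
  parts, the primitive \<open>P\<close> of \<open>p\<close> satisfies \<open>g(0) P(t) = - \<integral>\<^sub>0\<^sup>t P(t - s) g'(s) ds\<close>, an equation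
  of the second kind since \<open>g(0) = (u\<^sub>0, \<phi>) \<noteq> 0\<close>, so that \<open>P = 0\<close> by Gronwall's inequality.
\<close>

section \<open>Scalar products and adjoints over an \<open>rc_field\<close>\<close>

text \<open>That conjugation fixes 1 is not an axiom of the class; it comes from
  \<open>mult_conj\<close> at 1. Real homogeneity then extends it to all real scalars.\<close>

lemma conj_of_real: "conj (of_real r :: 'a::rc_field) = of_real r"
proof -
  have "conj (1::'a) = 1"
    using mult_conj[of "1::'a"] by simp
  then show ?thesis
    by (metis conj_scaleR scaleR_conv_of_real mult.right_neutral)
qed

context hilbert_space
begin

lemma ip_add_right: "ip x (y + z) = ip x y + ip x z"
  by (metis ip_add_left ip_commute conj_add)

lemma ip_smul_right: "ip x (smul c y) = conj c * ip x y"
  by (metis ip_smul_left ip_commute conj_mult)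

lemma ip_scaleR_left: "ip (r *\<^sub>R x) y = r *\<^sub>R ip x y"
  by (metis ip_smul_left smul_of_real scaleR_conv_of_real)

lemma ip_scaleR_right: "ip x (r *\<^sub>R y) = r *\<^sub>R ip x y"
  by (metis ip_smul_right smul_of_real scaleR_conv_of_real conj_of_real)

lemma ip_minus_left: "ip (- x) y = - ip x y"
  using ip_scaleR_left[of "-1"] by simp

lemma ip_minus_right: "ip x (- y) = - ip x y"
  using ip_scaleR_right[of _ "-1"] by simp

lemma ip_diff_left: "ip (x - y) z = ip x z - ip y z"
  using ip_add_left[of x "- y"] by (simp add: ip_minus_left)

lemma ip_diff_right: "ip x (y - z) = ip x y - ip x z"
  using ip_add_right[of x y "- z"] by (simp add: ip_minus_right)

text \<open>Cauchy-Schwarz: \<open>smul a y\<close> is the orthogonal projection of \<open>x\<close>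
  onto the line through \<open>y\<close>, and the squared norm of the remainder
  \<open>x - smul a y\<close> is nonnegative.\<close>

lemma norm_ip_le: "norm (ip x y) \<le> norm x * norm y"
proof (cases "y = 0")
  case True
  then show ?thesis
    using ip_scaleR_right[of x 0 y] by simp
next
  case False
  define a where "a = ip x y / of_real ((norm y)\<^sup>2)"
  have xy: "ip x y = a * of_real ((norm y)\<^sup>2)"
    using False by (simp add: a_def)
  have yx: "ip y x = conj a * of_real ((norm y)\<^sup>2)"
    using ip_commute[of y x] by (simp only: xy conj_mult conj_of_real)
  have aa: "a * conj a = of_real ((norm a)\<^sup>2)"
    using mult_conj[of a] by (simp add: scaleR_conv_of_real)
  have "(of_real ((norm (x - smul a y))\<^sup>2) :: 'k) = ip (x - smul a y) (x - smul a y)"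
    by (simp only: ip_self)
  also have "\<dots> = ip x x - conj a * ip x y - a * ip y x + a * conj a * ip y y"
    by (simp add: ip_diff_left ip_diff_right ip_smul_left ip_smul_right algebra_simps)
  also have "\<dots> = ip x x - a * conj a * of_real ((norm y)\<^sup>2)"
    by (simp add: xy yx ip_self algebra_simps)
  also have "\<dots> = of_real ((norm x)\<^sup>2 - (norm a)\<^sup>2 * (norm y)\<^sup>2)"
    by (simp add: aa ip_self)
  finally have "(norm (x - smul a y))\<^sup>2 = (norm x)\<^sup>2 - (norm a)\<^sup>2 * (norm y)\<^sup>2"
    by (simp only: of_real_eq_iff)
  then have "(norm a * norm y)\<^sup>2 \<le> (norm x)\<^sup>2"
    by (metis diff_ge_0_iff_ge power_mult_distrib zero_le_power2)
  then have "norm a * norm y \<le> norm x"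
    by (rule power2_le_imp_le) simp
  then have "norm a * norm y * norm y \<le> norm x * norm y"
    by (rule mult_right_mono) simp
  then show ?thesis
    by (simp add: xy norm_mult power2_eq_square mult.assoc)
qed

lemma bounded_linear_ip_left: "bounded_linear (\<lambda>x. ip x y)"
  by (rule bounded_linear_intro[where K = "norm y"])
    (simp_all add: ip_add_left ip_scaleR_left norm_ip_le)

text \<open>Two continuous functionals agree on a closed set, so agreement on \<open>D\<close>
  spreads to the whole space, where \<open>y - z\<close> serves as test vector.\<close>

lemma eq_if_ip_eq_on_dense:
  assumes "closure D = UNIV" "\<And>x. x \<in> D \<Longrightarrow> ip x y = ip x z"
  shows "y = z"
proof -
  have "closed {x. ip x y = ip x z}"
    by (intro closed_Collect_eq bounded_linear.continuous_on[OF bounded_linear_ip_left]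
        continuous_on_id)
  then have "closure D \<subseteq> {x. ip x y = ip x z}"
    using assms(2) by (intro closure_minimal) auto
  then have "ip (y - z) y = ip (y - z) z"
    using assms(1) by auto
  then have "ip (y - z) (y - z) = 0"
    by (simp add: ip_diff_right)
  then have "(norm (y - z))\<^sup>2 = 0"
    by (simp only: ip_self of_real_eq_0_iff)
  then show ?thesis
    by simp
qed

text \<open>Density makes the vector described by \<open>THE\<close> in \<open>adj\<close> unique,
  so the description really yields the adjoint relation.\<close>

lemma ip_adj:
  assumes "densely_defined D" "y \<in> adj_dom ip D A" "x \<in> D"
  shows "ip (A x) y = ip x (adj ip D A y)"
proof -
  have "\<exists>!z. \<forall>x\<in>D. ip (A x) y = ip x z"
  proof (rule ex_ex1I)
    show "\<exists>z. \<forall>x\<in>D. ip (A x) y = ip x z"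
      using assms(2) by (auto simp: adj_dom_def)
    show "z = z'" if "\<forall>x\<in>D. ip (A x) y = ip x z" "\<forall>x\<in>D. ip (A x) y = ip x z'" for z z'
      using assms(1) that by (intro eq_if_ip_eq_on_dense[of D]) (auto simp: densely_defined_def)
  qed
  from theI'[OF this] assms(3) show ?thesis
    by (simp add: adj_def)
qed

lemma continuous_on_graphD:
  assumes "linear_operator smul D A" "continuous_on_graph S D A u"
  shows "continuous_on S (\<lambda>t. A (u t))"
  unfolding continuous_on_def
proof
  fix t assume t: "t \<in> S"
  \<comment> \<open>\<open>linear_operator\<close> speaks of sums and multiples only, and only on
    \<open>D\<close>; a difference is handled as a sum with the multiple by -1.\<close>
  have diff: "A (x - y) = A x - A y" if "x \<in> D" "y \<in> D" for x y
  proof -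
    have "smul (- 1) y \<in> D"
      using assms(1) that(2) subspace_scale by (metis linear_operator_def)
    then have "A (x + smul (- 1) y) = A x + smul (- 1) (A y)"
      using assms(1) that unfolding linear_operator_def by metis
    then show ?thesis
      by simp
  qed
  have "((\<lambda>s. graph_norm A (u s - u t)) \<longlongrightarrow> 0) (at t within S)"
    using assms(2) t by (simp add: continuous_on_graph_def)
  then have "((\<lambda>s. A (u s) - A (u t)) \<longlongrightarrow> 0) (at t within S)"
  proof (rule Lim_null_comparison[rotated])
    show "\<forall>\<^sub>F s in at t within S. norm (A (u s) - A (u t)) \<le> graph_norm A (u s - u t)"
      using assms(2) t
      by (auto simp: eventually_at_filter graph_norm_def continuous_on_graph_def diff)
  qed
  then show "((\<lambda>s. A (u s)) \<longlongrightarrow> A (u t)) (at t within S)"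
    by (simp add: LIM_zero_iff)
qed

end

section \<open>Second derivatives on a compact interval\<close>

text \<open>\<open>Ck_on\<close> only asserts that some derivatives exist. On a nondegenerate
  interval derivatives are unique, end points included, so the witnesses coincide with
  \<open>deriv_on\<close> there.\<close>

lemma Ck_on_2_deriv_on:
  fixes u :: "real \<Rightarrow> 'a::real_normed_vector"
  assumes "Ck_on 2 {a..b} u" "a < b" "t \<in> {a..b}"
  shows "(u has_vector_derivative deriv_on {a..b} u t) (at t within {a..b})"
    and "(deriv_on {a..b} u has_vector_derivative deriv_on {a..b} (deriv_on {a..b} u) t)
           (at t within {a..b})"
proof -
  have deriv_on: "deriv_on {a..b} v t = v'"
    if "(v has_vector_derivative v') (at t within {a..b})" "t \<in> {a..b}"
    for v :: "real \<Rightarrow> 'a" and v' t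
    using vector_derivative_within_cbox[of a b t v v', unfolded box_real] assms(2) that
    by (simp add: deriv_on_def)
  obtain u' u'' where
    u': "\<And>t. t \<in> {a..b} \<Longrightarrow> (u has_vector_derivative u' t) (at t within {a..b})" and
    u'': "\<And>t. t \<in> {a..b} \<Longrightarrow> (u' has_vector_derivative u'' t) (at t within {a..b})"
    using assms(1) unfolding numeral_2_eq_2 Ck_on.simps by blast
  have eq: "deriv_on {a..b} u s = u' s" if "s \<in> {a..b}" for s
    using deriv_on u' that by blast
  then show "(u has_vector_derivative deriv_on {a..b} u t) (at t within {a..b})"
    using u' assms(3) by simp
  have "(deriv_on {a..b} u has_vector_derivative u'' t) (at t within {a..b})"
    using assms(3) eq u'' by (metis has_vector_derivative_transform)
  with deriv_on[OF this assms(3)]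
  show "(deriv_on {a..b} u has_vector_derivative deriv_on {a..b} (deriv_on {a..b} u) t)
           (at t within {a..b})"
    by simp
qed

text \<open>Intended for \<open>L\<close> the pairing with \<phi>: two solutions may differ as
  vector functions, but both pairings equal \<open>g\<close>. A bounded linear map commutes with
  differentiation, so the first-order fact \<open>unique\<close> can be applied twice.\<close>

lemma deriv_on_2_unique:
  fixes u v :: "real \<Rightarrow> 'a::real_normed_vector"
  assumes L: "bounded_linear L" and ab: "a < b" and t: "t \<in> {a..b}"
    and u: "Ck_on 2 {a..b} u" and v: "Ck_on 2 {a..b} v"
    and eq: "\<And>s. s \<in> {a..b} \<Longrightarrow> L (u s) = L (v s)"
  shows "L (deriv_on {a..b} (deriv_on {a..b} u) t) = L (deriv_on {a..b} (deriv_on {a..b} v) t)"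
proof -
  have unique: "L (d1 s) = L (d2 s)"
    if "(w1 has_vector_derivative d1 s) (at s within {a..b})"
      "(w2 has_vector_derivative d2 s) (at s within {a..b})"
      "\<And>s. s \<in> {a..b} \<Longrightarrow> L (w1 s) = L (w2 s)" "s \<in> {a..b}"
    for w1 w2 d1 d2 :: "real \<Rightarrow> 'a" and s
  proof -
    have "((\<lambda>s. L (w1 s)) has_vector_derivative L (d2 s)) (at s within {a..b})"
      using bounded_linear.has_vector_derivative[OF L that(2)] that(3,4)
      by (metis (no_types, lifting) has_vector_derivative_transform)
    then show ?thesis
      using vector_derivative_unique_within_closed_interval[OF ab, unfolded box_real]
        bounded_linear.has_vector_derivative[OF L that(1)] that(4) by blast
  qed
  have "L (deriv_on {a..b} u s) = L (deriv_on {a..b} v s)" if "s \<in> {a..b}" for s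
    using unique[of u "deriv_on {a..b} u" s v "deriv_on {a..b} v"]
      Ck_on_2_deriv_on(1)[OF u ab that] Ck_on_2_deriv_on(1)[OF v ab that] eq that by blast
  then show ?thesis
    using unique[of "deriv_on {a..b} u" "deriv_on {a..b} (deriv_on {a..b} u)" t
        "deriv_on {a..b} v" "deriv_on {a..b} (deriv_on {a..b} v)"]
      Ck_on_2_deriv_on(2)[OF u ab t] Ck_on_2_deriv_on(2)[OF v ab t] t by blast
qed

section \<open>Gronwall's inequality and Volterra equations\<close>

text \<open>Serves twice below: for the factor \<open>P (t - s)\<close> in the integration by parts,
  and for the substitution of \<open>t - s\<close> for \<open>s\<close> in the integral of
  \<open>\<bar>P\<bar>\<close>.\<close>

lemma integral_reflect_derivative:
  fixes q :: "real \<Rightarrow> real"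
  assumes "continuous_on {0..T} q" "t \<in> {0..T}" "s \<in> {0..t}"
  shows "((\<lambda>s. integral {0..t - s} q) has_real_derivative - q (t - s)) (at s within {0..t})"
proof -
  have q: "continuous_on {0..t} q"
    using assms by (auto intro: continuous_on_subset)
  have "((\<lambda>x. integral {0..x} q) has_real_derivative q (t - s)) (at (t - s) within {0..t})"
    using assms(3) by (intro integral_has_real_derivative[OF q]) auto
  then have "((\<lambda>x. integral {0..x} q) has_real_derivative q (t - s))
      (at (t - s) within (\<lambda>s. t - s) ` {0..t})"
    by (rule has_field_derivative_subset) auto
  moreover have "((\<lambda>s. t - s) has_real_derivative - 1) (at s within {0..t})"
    by (auto intro!: derivative_eq_intros)
  ultimately show ?thesis
    using DERIV_image_chain[of "\<lambda>x. integral {0..x} q" "q (t - s)" "\<lambda>s. t - s" s "{0..t}" "- 1"]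
    by (simp add: o_def)
qed

text \<open>With \<open>Q\<close> the integral of \<open>\<bar>P\<bar>\<close>, the function
  \<open>exp (- C * s) * Q s\<close> starts at 0 and has nonpositive derivative, so \<open>Q\<close>
  is at most 0; it is also nonnegative. The sign of \<open>C\<close> is irrelevant.\<close>

lemma gronwall_zero:
  fixes P :: "real \<Rightarrow> real"
  assumes P: "continuous_on {0..T} P" and t: "t \<in> {0..T}"
    and le: "\<And>t. t \<in> {0..T} \<Longrightarrow> \<bar>P t\<bar> \<le> C * integral {0..t} (\<lambda>s. \<bar>P s\<bar>)"
  shows "P t = 0"
proof -
  define Q where "Q = (\<lambda>t. integral {0..t} (\<lambda>s. \<bar>P s\<bar>))"
  have Q: "(Q has_real_derivative \<bar>P s\<bar>) (at s within {0..T})" if "s \<in> {0..T}" for s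
    unfolding Q_def
    by (rule integral_has_real_derivative) (use P that in \<open>auto intro: continuous_intros\<close>)
  have le: "\<bar>P s\<bar> \<le> C * Q s" if "s \<in> {0..T}" for s
    using le that by (simp add: Q_def)
  have deriv: "((\<lambda>s. exp (- C * s) * Q s) has_real_derivative
      exp (- C * s) * (\<bar>P s\<bar> - C * Q s)) (at s within {0..t})" if "s \<in> {0..t}" for s
  proof -
    have "(Q has_real_derivative \<bar>P s\<bar>) (at s within {0..t})"
      by (rule has_field_derivative_subset[OF Q]) (use t that in auto)
    then show ?thesis
      by (auto intro!: derivative_eq_intros simp: algebra_simps)
  qed
  have "exp (- C * t) * Q t \<le> exp (- C * 0) * Q 0"
  proof (rule DERIV_nonpos_imp_decreasing_open[of 0 t "\<lambda>s. exp (- C * s) * Q s"])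
    show "0 \<le> t"
      using t by simp
    show "continuous_on {0..t} (\<lambda>s. exp (- C * s) * Q s)"
      unfolding continuous_on_eq_continuous_within using DERIV_continuous[OF deriv] by blast
    fix s assume s: "0 < s" "s < t"
    then have "exp (- C * s) * (\<bar>P s\<bar> - C * Q s) \<le> 0"
      using le[of s] t by (simp add: mult_le_0_iff)
    \<comment> \<open>The monotonicity rule asks for two-sided derivatives, but only at interior
      points, where they agree with those within \<open>{0..t}\<close>.\<close>
    then show "\<exists>y. ((\<lambda>s. exp (- C * s) * Q s) has_real_derivative y) (at s) \<and> y \<le> 0"
      using deriv[of s] s by (auto simp: at_within_Icc_at)
  qed
  then have "Q t \<le> 0"
    by (simp add: Q_def mult_le_0_iff)
  moreover have "Q t \<ge> 0"
    unfolding Q_def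
  proof (intro integral_nonneg integrable_continuous_real continuous_on_rabs)
    show "continuous_on {0..t} P"
      by (rule continuous_on_subset[OF P]) (use t in auto)
  qed simp
  ultimately show ?thesis
    using le[OF t] by simp
qed

text \<open>Passing to the primitive \<open>P\<close> avoids differentiating a convolution with
  respect to its parameter; integration by parts needs only the continuity of \<open>p\<close> and
  \<open>g'\<close>.\<close>

lemma volterra_first_kind_zero:
  fixes p g g' :: "real \<Rightarrow> real"
  assumes T: "T > 0" and p: "continuous_on {0..T} p"
    and g: "\<And>t. t \<in> {0..T} \<Longrightarrow> (g has_vector_derivative g' t) (at t within {0..T})"
    and g': "continuous_on {0..T} g'" and g0: "g 0 \<noteq> 0"
    and eq: "\<And>t. t \<in> {0..T} \<Longrightarrow> integral {0..t} (\<lambda>s. p (t - s) * g s) = 0"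
    and t: "t \<in> {0..T}"
  shows "p t = 0"
proof -
  define P where "P = (\<lambda>t. integral {0..t} p)"
  have P': "(P has_real_derivative p s) (at s within {0..T})" if "s \<in> {0..T}" for s
    unfolding P_def by (rule integral_has_real_derivative) (use p that in auto)
  have P: "continuous_on {0..T} P"
    unfolding continuous_on_eq_continuous_within using DERIV_continuous[OF P'] by blast
  have refl: "continuous_on {0..t} (\<lambda>s. q (t - s))"
    if "continuous_on {0..T} q" "t \<in> {0..T}" for q :: "real \<Rightarrow> real" and t
    by (rule continuous_on_compose2[OF that(1)]) (use that(2) in \<open>auto intro!: continuous_intros\<close>)
  have g_cont: "continuous_on {0..T} g"
    unfolding continuous_on_eq_continuous_within using has_vector_derivative_continuous[OF g] by blast
  obtain M where M: "M > 0" "\<And>s. s \<in> {0..T} \<Longrightarrow> \<bar>g' s\<bar> \<le> M"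
    using compact_imp_bounded[OF compact_continuous_image[OF g' compact_Icc]]
    by (auto simp: bounded_pos)
  have "P t = 0" if "t \<in> {0..T}" for t
  proof (rule gronwall_zero[OF P that])
    fix t assume t: "t \<in> {0..T}"
    have sub: "continuous_on {0..t} q" if "continuous_on {0..T} q" for q :: "real \<Rightarrow> real"
      using that t by (auto intro: continuous_on_subset)
    have "((\<lambda>s. P (t - s) * g' s - p (t - s) * g s) has_integral P (t - t) * g t - P (t - 0) * g 0)
        {0..t}"
    proof (rule fundamental_theorem_of_calculus)
      show "0 \<le> t" using t by simp
      fix s assume s: "s \<in> {0..t}"
      have "(g has_real_derivative g' s) (at s within {0..t})"
        unfolding has_real_derivative_iff_has_vector_derivative
      by (rule has_vector_derivative_within_subset[OF g]) (use t s in auto)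
      moreover have "((\<lambda>s. P (t - s)) has_real_derivative - p (t - s)) (at s within {0..t})"
        unfolding P_def using integral_reflect_derivative[OF p t s] .
      ultimately show "((\<lambda>s. P (t - s) * g s) has_vector_derivative
          P (t - s) * g' s - p (t - s) * g s) (at s within {0..t})"
        unfolding has_real_derivative_iff_has_vector_derivative[symmetric]
        by (auto intro!: derivative_eq_intros)
    qed
    \<comment> \<open>Since \<open>P 0 = 0\<close>, only the boundary term at \<open>s = 0\<close>
      survives.\<close>
    then have "integral {0..t} (\<lambda>s. P (t - s) * g' s - p (t - s) * g s) = - P t * g 0"
      by (simp add: P_def integral_unique)
    moreover have "integral {0..t} (\<lambda>s. P (t - s) * g' s - p (t - s) * g s) =
        integral {0..t} (\<lambda>s. P (t - s) * g' s) - integral {0..t} (\<lambda>s. p (t - s) * g s)"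
      by (intro integral_diff integrable_continuous_real continuous_on_mult refl sub
          P p g' g_cont t)
    ultimately have parts: "integral {0..t} (\<lambda>s. P (t - s) * g' s) = - P t * g 0"
      using eq[OF t] by simp
    have abs_P: "continuous_on {0..T} (\<lambda>s. \<bar>P s\<bar>)"
      using P by (intro continuous_intros)
    \<comment> \<open>Substitution of \<open>t - s\<close> for \<open>s\<close>, carried out with
      the explicit antiderivative
      \<open>- integral {0..t - s} (\<lambda>s. \<bar>P s\<bar>)\<close>.\<close>
    have "((\<lambda>s. \<bar>P (t - s)\<bar>) has_integral
        - integral {0..t - t} (\<lambda>s. \<bar>P s\<bar>) - - integral {0..t - 0} (\<lambda>s. \<bar>P s\<bar>)) {0..t}"
    proof (rule fundamental_theorem_of_calculus)
      show "0 \<le> t" using t by simp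
      fix s assume s: "s \<in> {0..t}"
      show "((\<lambda>s. - integral {0..t - s} (\<lambda>s. \<bar>P s\<bar>)) has_vector_derivative \<bar>P (t - s)\<bar>)
          (at s within {0..t})"
        unfolding has_real_derivative_iff_has_vector_derivative[symmetric]
        using DERIV_minus[OF integral_reflect_derivative[OF abs_P t s]] by simp
    qed
    then have bound: "((\<lambda>s. M * \<bar>P (t - s)\<bar>) has_integral M * integral {0..t} (\<lambda>s. \<bar>P s\<bar>)) {0..t}"
      by (intro has_integral_mult_right) simp
    have "norm (integral {0..t} (\<lambda>s. P (t - s) * g' s)) \<le>
        integral {0..t} (\<lambda>s. M * \<bar>P (t - s)\<bar>)"
    proof (rule integral_norm_bound_integral)
      show "(\<lambda>s. P (t - s) * g' s) integrable_on {0..t}"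
        by (intro integrable_continuous_real continuous_on_mult refl sub P g' t)
      show "(\<lambda>s. M * \<bar>P (t - s)\<bar>) integrable_on {0..t}"
        using bound by blast
      show "norm (P (t - s) * g' s) \<le> M * \<bar>P (t - s)\<bar>" if "s \<in> {0..t}" for s
        using M(2)[of s] t that mult_right_mono[of "\<bar>g' s\<bar>" M "\<bar>P (t - s)\<bar>"]
        by (simp add: abs_mult mult.commute)
    qed
    then have "\<bar>P t\<bar> * \<bar>g 0\<bar> \<le> M * integral {0..t} (\<lambda>s. \<bar>P s\<bar>)"
      unfolding integral_unique[OF bound] by (simp add: parts abs_mult)
    \<comment> \<open>The Gronwall constant is the bound \<open>M\<close> of
      \<open>\<bar>g'\<bar>\<close> divided by \<open>\<bar>g 0\<bar>\<close>.\<close>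
    then show "\<bar>P t\<bar> \<le> M / \<bar>g 0\<bar> * integral {0..t} (\<lambda>s. \<bar>P s\<bar>)"
      using g0 by (simp add: field_simps)
  qed
  \<comment> \<open>\<open>P\<close> vanishes on the whole interval, so its derivative
    \<open>p t\<close> is also a derivative of the zero function.\<close>
  then have "((\<lambda>_. 0) has_vector_derivative p t) (at t within {0..T})"
    using has_vector_derivative_transform[OF t, of "\<lambda>_. 0" P] P'[OF t]
    by (simp add: has_real_derivative_iff_has_vector_derivative)
  then show ?thesis
    using t T vector_derivative_unique_within_closed_interval[of 0 T t "\<lambda>_. 0" "p t" 0,
        unfolded box_real] by simp
qed

section \<open>The identification problem\<close>

text \<open>The equation evaluates the kernel only at points \<open>t - s\<close> of
  \<open>{0..T}\<close>, and only there can two kernels be shown to agree.\<close>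

lemma direct_solution_kernel_cong:
  assumes "\<And>t. t \<in> {0..T} \<Longrightarrow> h t = k t" "direct_solution T D A u0 u1 f k u"
  shows "direct_solution T D A u0 u1 f h u"
proof -
  have "integral {0..t} (\<lambda>s. h (t - s) *\<^sub>R A (u s)) = integral {0..t} (\<lambda>s. k (t - s) *\<^sub>R A (u s))"
    if "t \<in> {0..T}" for t
    by (rule integral_cong) (use that assms(1) in auto)
  with assms(2) show ?thesis
    by (simp add: direct_solution_def)
qed

text \<open>The pairing with \<phi> is bounded and linear, so it passes under the integral; there
  the adjoint relation replaces \<open>A (u s)\<close> by \<open>l0\<close> times
  \<open>g s\<close>.\<close>

lemma (in hilbert_space) ip_deriv_on_2:
  assumes "linear_operator smul D A" "densely_defined D"
    and "\<phi> \<in> adj_dom ip D A" "adj ip D A \<phi> = l0 *\<^sub>R \<phi>"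
    and g: "continuous_on {0..T} g"
    and sol: "IP_solution ip T D A \<phi> u0 u1 f g u h" and t: "t \<in> {0..T}"
  shows "ip (deriv_on {0..T} (deriv_on {0..T} u) t) \<phi> =
           of_real (l0 * integral {0..t} (\<lambda>s. h (t - s) * g s)) + ip (f t) \<phi>"
proof -
  have h: "continuous_on {0..T} h" and u: "direct_solution T D A u0 u1 f h u"
    and ip_u: "\<And>s. s \<in> {0..T} \<Longrightarrow> ip (u s) \<phi> = of_real (g s)"
    using sol by (auto simp: IP_solution_def)
  have sub: "{0..t} \<subseteq> {0..T}"
    using t by auto
  have graph: "continuous_on_graph {0..T} D A u"
    using u by (simp add: direct_solution_def)
  have h': "continuous_on {0..t} (\<lambda>s. h (t - s))"
    by (rule continuous_on_compose2[OF h]) (use t in \<open>auto intro!: continuous_intros\<close>)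
  have "(\<lambda>s. h (t - s) *\<^sub>R A (u s)) integrable_on {0..t}"
    using continuous_on_graphD[OF assms(1) graph] sub h'
    by (intro integrable_continuous_real continuous_on_scaleR) (auto intro: continuous_on_subset)
  from has_integral_linear[OF integrable_integral[OF this] bounded_linear_ip_left[of \<phi>]]
  have "((\<lambda>s. ip (h (t - s) *\<^sub>R A (u s)) \<phi>) has_integral
      ip (integral {0..t} (\<lambda>s. h (t - s) *\<^sub>R A (u s))) \<phi>) {0..t}"
    by (simp add: o_def)
  moreover have "ip (h (t - s) *\<^sub>R A (u s)) \<phi> = of_real (l0 * (h (t - s) * g s))"
    if "s \<in> {0..t}" for s
  proof -
    have "u s \<in> D"
      using graph that sub by (auto simp: continuous_on_graph_def)
    \<comment> \<open>The eigenvalue leaves the conjugate-linear slot unchanged because it is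
      real.\<close>
    then have "ip (A (u s)) \<phi> = l0 *\<^sub>R of_real (g s)"
      using ip_adj[OF assms(2,3)] ip_u[of s] that sub by (simp add: assms(4) ip_scaleR_right)
    then show ?thesis
      by (simp add: ip_scaleR_left scaleR_conv_of_real mult_ac)
  qed
  ultimately have 1: "((\<lambda>s. of_real (l0 * (h (t - s) * g s))) has_integral
      ip (integral {0..t} (\<lambda>s. h (t - s) *\<^sub>R A (u s))) \<phi>) {0..t}"
    by (subst (asm) has_integral_cong) auto
  have "(\<lambda>s. h (t - s) * g s) integrable_on {0..t}"
    using h' g sub
    by (intro integrable_continuous_real continuous_on_mult) (auto intro: continuous_on_subset)
  from has_integral_mult_right[OF integrable_integral[OF this], of l0]
  have "((\<lambda>s. l0 * (h (t - s) * g s)) has_integral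
      l0 * integral {0..t} (\<lambda>s. h (t - s) * g s)) {0..t}" .
  \<comment> \<open>The pairing takes values in \<open>'k\<close> while \<open>h\<close> and
    \<open>g\<close> are real, so the real integral is embedded by \<open>of_real\<close>.\<close>
  from has_integral_linear[OF this bounded_linear_of_real[where 'a = 'k]]
  have "((\<lambda>s. of_real (l0 * (h (t - s) * g s)) :: 'k) has_integral
      of_real (l0 * integral {0..t} (\<lambda>s. h (t - s) * g s))) {0..t}"
    by (simp only: o_def)
  from has_integral_unique[OF 1 this] show ?thesis
    using u t by (simp add: direct_solution_def ip_add_left)
qed

theorem theorem1p1:
  fixes smul :: "'k::rc_field \<Rightarrow> 'h::banach \<Rightarrow> 'h"
    and ip :: "'h \<Rightarrow> 'h \<Rightarrow> 'k"
    and D :: "'h set" and A :: "'h \<Rightarrow> 'h"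
    and \<phi> u0 u1 :: 'h
    and l0 T :: real
    and f :: "real \<Rightarrow> 'h" and g :: "real \<Rightarrow> real"
  assumes "hilbert_space smul ip"
    and "linear_operator smul D A" "closed_operator D A" "densely_defined D"
    and "\<phi> \<in> adj_dom ip D A" "adj ip D A \<phi> = l0 *\<^sub>R \<phi>" "l0 \<noteq> 0" "norm \<phi> = 1"
    and "T > 0"
    and "Ck_on 1 {0..T} f"
    and "u0 \<in> D" "ip u0 \<phi> \<noteq> 0"
    and "Ck_on 2 {0..T} g"
    and "\<And>u h. IP_solution ip T D A \<phi> u0 u1 f g u h \<Longrightarrow>
           \<exists>v. direct_solution T D A u0 u1 f h v \<and>
             (\<forall>w. direct_solution T D A u0 u1 f h w \<longrightarrow> (\<forall>t\<in>{0..T}. w t = v t))"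
  shows "\<And>u h v k. IP_solution ip T D A \<phi> u0 u1 f g u h \<Longrightarrow>
           IP_solution ip T D A \<phi> u0 u1 f g v k \<Longrightarrow>
           (\<forall>t\<in>{0..T}. u t = v t) \<and> (\<forall>t\<in>{0..T}. h t = k t)"
proof -
  interpret hilbert_space smul ip by fact
  fix u h v k
  assume u: "IP_solution ip T D A \<phi> u0 u1 f g u h" and v: "IP_solution ip T D A \<phi> u0 u1 f g v k"
  note g = Ck_on_2_deriv_on[OF \<open>Ck_on 2 {0..T} g\<close> \<open>T > 0\<close>]
  have g_cont: "continuous_on {0..T} g"
    unfolding continuous_on_eq_continuous_within
    using has_vector_derivative_continuous[OF g(1)] by blast
  have g': "continuous_on {0..T} (deriv_on {0..T} g)"
    unfolding continuous_on_eq_continuous_within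
    using has_vector_derivative_continuous[OF g(2)] by blast
  have h: "continuous_on {0..T} h" and k: "continuous_on {0..T} k"
    and hu: "direct_solution T D A u0 u1 f h u" and kv: "direct_solution T D A u0 u1 f k v"
    and ip_u: "\<And>s. s \<in> {0..T} \<Longrightarrow> ip (u s) \<phi> = of_real (g s)"
    and ip_v: "\<And>s. s \<in> {0..T} \<Longrightarrow> ip (v s) \<phi> = of_real (g s)"
    using u v by (auto simp: IP_solution_def)
  \<comment> \<open>The measurement at time 0 and the initial condition give the nonvanishing that
    turns the Volterra equation into one of the second kind.\<close>
  have "of_real (g 0) = ip u0 \<phi>"
    using ip_u[of 0] hu \<open>T > 0\<close> by (simp add: direct_solution_def)
  then have g0: "g 0 \<noteq> 0"
    using \<open>ip u0 \<phi> \<noteq> 0\<close> by auto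
  note second = ip_deriv_on_2[OF \<open>linear_operator smul D A\<close> \<open>densely_defined D\<close>
      \<open>\<phi> \<in> adj_dom ip D A\<close> \<open>adj ip D A \<phi> = l0 *\<^sub>R \<phi>\<close> g_cont]
  have volterra: "integral {0..t} (\<lambda>s. (h (t - s) - k (t - s)) * g s) = 0" if t: "t \<in> {0..T}" for t
  proof -
    have "ip (deriv_on {0..T} (deriv_on {0..T} u) t) \<phi> =
        ip (deriv_on {0..T} (deriv_on {0..T} v) t) \<phi>"
      using hu kv ip_u ip_v
      by (intro deriv_on_2_unique[OF bounded_linear_ip_left \<open>T > 0\<close> t])
        (auto simp: direct_solution_def)
    \<comment> \<open>The contribution of \<open>f\<close> is the same for both solutions and
      cancels.\<close>
    then have "(of_real (l0 * integral {0..t} (\<lambda>s. h (t - s) * g s)) :: 'k) =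
        of_real (l0 * integral {0..t} (\<lambda>s. k (t - s) * g s))"
      unfolding second[OF u t] second[OF v t] by simp
    then have "integral {0..t} (\<lambda>s. h (t - s) * g s) = integral {0..t} (\<lambda>s. k (t - s) * g s)"
      using \<open>l0 \<noteq> 0\<close> by (simp only: of_real_eq_iff mult_cancel_left simp_thms)
    moreover have "(\<lambda>s. q (t - s) * g s) integrable_on {0..t}"
      if "continuous_on {0..T} q" for q :: "real \<Rightarrow> real"
    proof (intro integrable_continuous_real continuous_on_mult)
      show "continuous_on {0..t} (\<lambda>s. q (t - s))"
        by (rule continuous_on_compose2[OF that]) (use t in \<open>auto intro!: continuous_intros\<close>)
      show "continuous_on {0..t} g"
        using g_cont t by (auto intro: continuous_on_subset)
    qed
    ultimately show ?thesis
      using h k by (simp add: left_diff_distrib integral_diff)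
  qed
  have hk: "h t = k t" if "t \<in> {0..T}" for t
    using volterra_first_kind_zero[OF \<open>T > 0\<close> continuous_on_diff[OF h k] g(1) g' g0 volterra that]
    by simp
  \<comment> \<open>With the kernels identified, \<open>u\<close> and \<open>v\<close> solve the
    same direct problem, whose assumed uniqueness gives \<open>u = v\<close> on
    \<open>{0..T}\<close>.\<close>
  have "direct_solution T D A u0 u1 f h v"
    using direct_solution_kernel_cong[OF hk kv] .
  moreover obtain w where
    "\<And>w'. direct_solution T D A u0 u1 f h w' \<Longrightarrow> \<forall>t\<in>{0..T}. w' t = w t"
    using assms(14)[OF u] by blast
  ultimately show "(\<forall>t\<in>{0..T}. u t = v t) \<and> (\<forall>t\<in>{0..T}. h t = k t)"
    using hu hk by metis
qed

end
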